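(* Let $\mathcal{G}$ be a hereditary graph class with $\operatorname{mad}(\mathcal{G})\le d$. Then for every graph $H$ and every $x\in\{u,l,f\}$, $$\operatorname{ic}_x^{\mathcal{G}}(H)\le 2d\cdot\operatorname{c}_x^{\mathcal{G}}(H)^2.$$ In particular, for such $\mathcal{G}$, every graph class $\mathcal{H}$ is $(\operatorname{ic}_x^{\mathcal{G}},\operatorname{c}_x^{\mathcal{G}})$-bounded.
   Context: Graphs are finite and simple; graph classes are closed under isomorphism. A class is hereditary if it is closed under taking induced subgraphs. The maximum average degree of $G$ is $\operatorname{mad}(G)=\max\{2|E(G')|/|V(G')| : G'\subseteq G,\ |V(G')|\ge 1\}$, and $\operatorname{mad}(\mathcal{G})=\sup_{G\in\mathcal{G}}\operatorname{mad}(G)$. A $\mathcal{G}$-cover of a graph $H$ is a graph homomorphism $\varphi\colon G_1\sqcup\dots\sqcup G_t\to H$ (disjoint union) with $G_i\in\mathcal{G}$ for all $i$, such that every edge of $H$ is the image of some edge. It is injective if each $G_i$ is isomorphic via $\varphi$ to its image $\varphi(G_i)\subseteq H$. A subgraph $H'$ of $H$ is weak induced if each connected component of $H'$ is an induced subgraph of $H$; a cover is weak induced if each image $\varphi(G_i)$ is a weak induced subgraph of $H$. $\overline{\mathcal{G}}$ denotes the class of all vertex-disjoint unions of graphs in $\mathcal{G}$. Covering numbers of $H$: - union: $\operatorname{c}_u^{\mathcal{G}}(H)$ is the smallest $t$ such that $H$ has an injective $\overline{\mathcal{G}}$-cover with $t$ guests; - local: $\operatorname{c}_l^{\mathcal{G}}(H)$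 is the smallest $\ell$ such that $H$ has an injective $\mathcal{G}$-cover $\varphi$ (any number of guests) with $|\varphi^{-1}(v)|\le\ell$ for all $v\in V(H)$; - folded: $\operatorname{c}_f^{\mathcal{G}}(H)$ is the smallest $\ell$ such that $H$ has a (not necessarily injective) $\mathcal{G}$-cover $\varphi$ with $|\varphi^{-1}(v)|\le\ell$ for all $v\in V(H)$. The induced variants $\operatorname{ic}_u^{\mathcal{G}}(H),\operatorname{ic}_l^{\mathcal{G}}(H),\operatorname{ic}_f^{\mathcal{G}}(H)$ are defined in the same way with the cover additionally required to be weak induced. Each number is $\infty$ if no such cover exists, and inequalities are asserted only when $\operatorname{c}_x^{\mathcal{G}}(H)<\infty$. A graph class $\mathcal{H}$ is $(\operatorname{ic}_x^{\mathcal{G}},\operatorname{c}_x^{\mathcal{G}})$-bounded if there is a function $f\colon\mathbb{N}\to\mathbb{N}$ with $\operatorname{ic}_x^{\mathcal{G}}(H)\le f(\operatorname{c}_x^{\mathcal{G}}(H))$ for every $H\in\mathcal{H}$ with $\operatorname{c}_x^{\mathcal{G}}(H)<\infty$. *)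

theory Defs
  imports "Graph_Theory.Graph_Theory" "HOL-Library.Extended_Real"
begin

text \<open>
  A finite simple graph is a \<^const>\<open>pair_graph\<close>: a finite, loop-free, symmetric set of arcs
  between finitely many vertices, so that every edge contributes its two orientations.
  The null graph is included. Guests live on vertices of type \<^typ>\<open>nat\<close>, which
  realises every finite graph up to isomorphism; hosts may have vertices of any type.
\<close>

type_synonym 'a ugraph = "'a pair_pre_digraph"

definition edge_set :: "'a ugraph \<Rightarrow> 'a set set" where
  "edge_set G = {{u, v} | u v. (u, v) \<in> parcs G}"

definition graph_class :: "'a ugraph set \<Rightarrow> bool" where
  "graph_class \<G> \<longleftrightarrow>
     (\<forall>G\<in>\<G>. pair_graph G) \<and>
     (\<forall>G\<in>\<G>. \<forall>G' :: 'a ugraph. digraph_iso (with_proj G) (with_proj G') \<longrightarrow> G' \<in> \<G>)"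

definition hereditary :: "'a ugraph set \<Rightarrow> bool" where
  "hereditary \<G> \<longleftrightarrow>
     (\<forall>G\<in>\<G>. \<forall>G' :: 'a ugraph. induced_subgraph (with_proj G') (with_proj G) \<longrightarrow> G' \<in> \<G>)"

text \<open>The maximum is over the empty set for the null graph, where the value is set to 0.\<close>

definition mad :: "'a ugraph \<Rightarrow> real" where
  "mad G = (if pverts G = {} then 0 else
     Max {2 * real (card (edge_set G')) / real (card (pverts G')) | G' :: 'a ugraph.
            pair_graph G' \<and> subgraph (with_proj G') (with_proj G) \<and> card (pverts G') \<ge> 1})"

definition mad_class :: "'a ugraph set \<Rightarrow> ereal" where
  "mad_class \<G> = (SUP G\<in>\<G>. ereal (mad G))"

definition disj_union :: "nat \<Rightarrow> (nat \<Rightarrow> 'g ugraph) \<Rightarrow> (nat \<times> 'g) ugraph" where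
  "disj_union t Gs =
     \<lparr> pverts = (SIGMA i:{..<t}. pverts (Gs i)),
       parcs = {((i, u), (i, v)) | i u v. i < t \<and> (u, v) \<in> parcs (Gs i)} \<rparr>"

definition disj_union_closure :: "nat ugraph set \<Rightarrow> nat ugraph set" where
  "disj_union_closure \<G> =
     {F. \<exists>t Gs. (\<forall>i<t. Gs i \<in> \<G>) \<and> digraph_iso (with_proj (disj_union t Gs)) (with_proj F)}"

definition graph_hom :: "('a \<Rightarrow> 'b) \<Rightarrow> 'a ugraph \<Rightarrow> 'b ugraph \<Rightarrow> bool" where
  "graph_hom f G H \<longleftrightarrow>
     (\<forall>v\<in>pverts G. f v \<in> pverts H) \<and> (\<forall>(u, v)\<in>parcs G. (f u, f v) \<in> parcs H)"

text \<open>
  The guests of a cover are \<open>Gs 0, \<dots>, Gs (t - 1)\<close>. No guest at all (\<open>t = 0\<close>) is allowed; this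
  covers exactly the edgeless hosts, since only edges have to be covered.
\<close>

definition is_cover ::
  "'g ugraph set \<Rightarrow> 'a ugraph \<Rightarrow> nat \<Rightarrow> (nat \<Rightarrow> 'g ugraph) \<Rightarrow> (nat \<times> 'g \<Rightarrow> 'a) \<Rightarrow> bool" where
  "is_cover \<G> H t Gs \<phi> \<longleftrightarrow>
     (\<forall>i<t. Gs i \<in> \<G>) \<and>
     graph_hom \<phi> (disj_union t Gs) H \<and>
     parcs H \<subseteq> map_prod \<phi> \<phi> ` parcs (disj_union t Gs)"

text \<open>
  The map on arcs induced by a vertex map \<open>f\<close>. Then \<open>app_iso (vertex_map f) G\<close> is the image of
  \<open>G\<close> under \<open>f\<close> (also for non-injective \<open>f\<close>), and
  \<open>digraph_isomorphism G (vertex_map f)\<close> says that \<open>f\<close> is an isomorphism onto this image.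
\<close>

definition vertex_map :: "('a \<Rightarrow> 'b) \<Rightarrow> ('a, 'a \<times> 'a, 'b, 'b \<times> 'b) digraph_isomorphism" where
  "vertex_map f =
     \<lparr> iso_verts = f, iso_arcs = map_prod f f, iso_head = snd, iso_tail = fst \<rparr>"

definition injective_cover ::
  "nat \<Rightarrow> (nat \<Rightarrow> 'g ugraph) \<Rightarrow> (nat \<times> 'g \<Rightarrow> 'a) \<Rightarrow> bool" where
  "injective_cover t Gs \<phi> \<longleftrightarrow>
     (\<forall>i<t. pre_digraph.digraph_isomorphism (with_proj (Gs i)) (vertex_map (\<lambda>v. \<phi> (i, v))))"

text \<open>For symmetric digraphs, \<^const>\<open>pre_digraph.sccs\<close> are the connected components.\<close>

definition weak_induced_subgraph ::
  "('a, 'b) pre_digraph \<Rightarrow> ('a, 'b) pre_digraph \<Rightarrow> bool" where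
  "weak_induced_subgraph F H \<longleftrightarrow>
     subgraph F H \<and> (\<forall>C\<in>pre_digraph.sccs F. induced_subgraph C H)"

definition weak_induced_cover ::
  "'a ugraph \<Rightarrow> nat \<Rightarrow> (nat \<Rightarrow> 'g ugraph) \<Rightarrow> (nat \<times> 'g \<Rightarrow> 'a) \<Rightarrow> bool" where
  "weak_induced_cover H t Gs \<phi> \<longleftrightarrow>
     (\<forall>i<t. weak_induced_subgraph
              (app_iso (vertex_map (\<lambda>v. \<phi> (i, v))) (with_proj (Gs i))) (with_proj H))"

definition fibres_bounded ::
  "'a ugraph \<Rightarrow> nat \<Rightarrow> (nat \<Rightarrow> 'g ugraph) \<Rightarrow> (nat \<times> 'g \<Rightarrow> 'a) \<Rightarrow> nat \<Rightarrow> bool" where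
  "fibres_bounded H t Gs \<phi> l \<longleftrightarrow>
     (\<forall>v\<in>pverts H. card {p \<in> pverts (disj_union t Gs). \<phi> p = v} \<le> l)"

datatype covering_variant = Union_cover | Local_cover | Folded_cover

text \<open>
  If \<open>ind\<close> holds, only weak induced covers are admitted. The infimum of the empty set
  is \<open>\<infinity>\<close>.
\<close>

fun covering_number ::
  "bool \<Rightarrow> covering_variant \<Rightarrow> nat ugraph set \<Rightarrow> 'a ugraph \<Rightarrow> enat" where
  "covering_number ind Union_cover \<G> H =
     Inf {enat t | t. \<exists>Gs \<phi>. is_cover (disj_union_closure \<G>) H t Gs \<phi> \<and>
            injective_cover t Gs \<phi> \<and> (ind \<longrightarrow> weak_induced_cover H t Gs \<phi>)}"
| "covering_number ind Local_cover \<G> H =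
     Inf {enat l | l. \<exists>t Gs \<phi>. is_cover \<G> H t Gs \<phi> \<and> injective_cover t Gs \<phi> \<and>
            fibres_bounded H t Gs \<phi> l \<and> (ind \<longrightarrow> weak_induced_cover H t Gs \<phi>)}"
| "covering_number ind Folded_cover \<G> H =
     Inf {enat l | l. \<exists>t Gs \<phi>. is_cover \<G> H t Gs \<phi> \<and>
            fibres_bounded H t Gs \<phi> l \<and> (ind \<longrightarrow> weak_induced_cover H t Gs \<phi>)}"

abbreviation cov :: "covering_variant \<Rightarrow> nat ugraph set \<Rightarrow> 'a ugraph \<Rightarrow> enat" where
  "cov \<equiv> covering_number False"

abbreviation icov :: "covering_variant \<Rightarrow> nat ugraph set \<Rightarrow> 'a ugraph \<Rightarrow> enat" where
  "icov \<equiv> covering_number True"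

definition param_bounded ::
  "('a ugraph \<Rightarrow> enat) \<Rightarrow> ('a ugraph \<Rightarrow> enat) \<Rightarrow> 'a ugraph set \<Rightarrow> bool" where
  "param_bounded p q \<H> \<longleftrightarrow>
     (\<exists>f :: nat \<Rightarrow> nat. \<forall>H\<in>\<H>. q H < \<infinity> \<longrightarrow> p H \<le> enat (f (the_enat (q H))))"

end

theory Submission
  imports Defs
begin

text \<open>
  Let \<open>H\<close> have a cover by guests of average degree at most \<open>d\<close> in all subgraphs, with fibres of
  size at most \<open>k\<close>. A union cover with \<open>k\<close> guests is of this kind. Counting
  edges in the preimage of a vertex set shows that all subgraphs of \<open>H\<close> have average degree at
  most \<open>d * k\<close> (\<open>sparse_covered\<close>), so \<open>H\<close> is \<open>m\<close>-degenerate for \<open>m = \<lfloor>d * k\<rfloor>\<close>.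

  The main point is that the edges of an \<open>m\<close>-degenerate graph can be coloured with \<open>2 * m\<close>
  colours such that every colour class is a forest of stars, each star being induced in the
  whole graph (\<open>induced_star_colouring\<close>); this is a greedy colouring along a degeneracy order.

  Now choose for each edge of \<open>H\<close> one guest edge above it, and split every guest
  into the stars formed by its chosen edges of equal colour (\<open>star_system_exists\<close>). A substar of
  an induced star is induced, hence the images of these stars are induced in \<open>H\<close>. A star is also
  an induced subgraph of its guest, because any guest edge between two leaves would be mapped to
  an edge of \<open>H\<close>; so it belongs to the hereditary class. Each vertex of a guest lies in at most one
  star of each colour, which gives fibres of size at most \<open>2 * m * k \<le> 2 * d * k\<^sup>2\<close> for the local
  and the folded number (\<open>induced_star_cover\<close>). For the union number, each of the \<open>k\<close> guests is
  replaced by \<open>2 * m\<close> star forests, which are disjoint unions of members of the class and whose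
  images have the images of the stars as components (\<open>star_forest_cover\<close>).
\<close>

section \<open>Graphs as symmetric relations\<close>

definition induced :: "'a ugraph \<Rightarrow> 'a set \<Rightarrow> 'a ugraph" where
  "induced G X = \<lparr> pverts = X, parcs = parcs G \<inter> X \<times> X \<rparr>"

definition image_graph :: "('a \<Rightarrow> 'b) \<Rightarrow> 'a ugraph \<Rightarrow> 'b ugraph" where
  "image_graph f G = \<lparr> pverts = f ` pverts G, parcs = map_prod f f ` parcs G \<rparr>"

lemma induced_simps [simp]:
  "pverts (induced G X) = X" "parcs (induced G X) = parcs G \<inter> X \<times> X"
  by (simp_all add: induced_def)

lemma image_graph_simps [simp]:
  "pverts (image_graph f G) = f ` pverts G"
  "parcs (image_graph f G) = map_prod f f ` parcs G"
  by (simp_all add: image_graph_def)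

lemma disj_union_simps [simp]:
  "pverts (disj_union t Gs) = (SIGMA i:{..<t}. pverts (Gs i))"
  "parcs (disj_union t Gs) = {((i, u), (i, v)) | i u v. i < t \<and> (u, v) \<in> parcs (Gs i)}"
  by (simp_all add: disj_union_def)

lemma wf_digraph_with_proj_iff:
  "wf_digraph (with_proj G) \<longleftrightarrow> parcs G \<subseteq> pverts G \<times> pverts G"
  by (force simp: wf_digraph_def)

lemma pair_graph_iff:
  "pair_graph G \<longleftrightarrow> finite (pverts G) \<and> parcs G \<subseteq> pverts G \<times> pverts G \<and>
     irrefl (parcs G) \<and> sym (parcs G)" (is "?L \<longleftrightarrow> ?R")
proof
  assume ?L
  then interpret pair_graph G .
  show ?R
    using pair_finite_verts in_arcsD1 in_arcsD2 no_loops'[of u u for u] arcs_symmetric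
    by (auto simp: irrefl_def sym_def)
next
  assume R: ?R
  then have "finite (parcs G)"
    by (meson finite_SigmaI finite_subset)
  with R show ?L
    by unfold_locales (auto simp: irrefl_def symmetric_def)
qed

lemma induced_subgraph_with_proj_iff:
  "induced_subgraph (with_proj G') (with_proj G) \<longleftrightarrow>
     pverts G' \<subseteq> pverts G \<and> parcs G' = parcs G \<inter> pverts G' \<times> pverts G' \<and>
     parcs G \<subseteq> pverts G \<times> pverts G"
  by (auto simp: induced_subgraph_def subgraph_def wf_digraph_with_proj_iff compatible_def)

lemma subgraph_with_proj_iff:
  "subgraph (with_proj G') (with_proj G) \<longleftrightarrow>
     pverts G' \<subseteq> pverts G \<and> parcs G' \<subseteq> parcs G \<and>
     parcs G \<subseteq> pverts G \<times> pverts G \<and> parcs G' \<subseteq> pverts G' \<times> pverts G'"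
  by (auto simp: subgraph_def wf_digraph_with_proj_iff compatible_def)

lemma isomorphism_vertex_map_iff:
  "pre_digraph.digraph_isomorphism (with_proj G) (vertex_map f) \<longleftrightarrow>
     parcs G \<subseteq> pverts G \<times> pverts G \<and> inj_on f (pverts G)"
proof -
  have "inj_on (map_prod f f) (parcs G)"
    if "inj_on f (pverts G)" "parcs G \<subseteq> pverts G \<times> pverts G"
    using map_prod_inj_on[OF that(1) that(1)] that(2) by (rule inj_on_subset)
  then show ?thesis
    by (auto simp: pre_digraph.digraph_isomorphism_def vertex_map_def wf_digraph_with_proj_iff)
qed

lemma app_iso_vertex_map:
  "app_iso (vertex_map f) (with_proj G) = with_proj (image_graph f G)"
  by (simp add: app_iso_def vertex_map_def with_proj_def image_graph_def)

lemma digraph_iso_with_proj_iff: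
  "digraph_iso (with_proj G) (with_proj F) \<longleftrightarrow>
     parcs G \<subseteq> pverts G \<times> pverts G \<and> (\<exists>f. inj_on f (pverts G) \<and> F = image_graph f G)"
    (is "?L \<longleftrightarrow> ?R")
proof
  assume ?L
  then obtain h where h: "pre_digraph.digraph_isomorphism (with_proj G) h"
    "with_proj F = app_iso h (with_proj G)"
    by (auto simp: digraph_iso_def)
  have ends: "iso_tail h = fst" "iso_head h = snd"
    and F: "pverts F = iso_verts h ` pverts G" "parcs F = iso_arcs h ` parcs G"
    using h(2) by (simp_all add: with_proj_def app_iso_def)
  have arcs: "iso_arcs h a = map_prod (iso_verts h) (iso_verts h) a" if "a \<in> parcs G" for a
    using h(1) that
    by (auto simp: pre_digraph.digraph_isomorphism_def ends prod_eq_iff)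
  have "F = image_graph (iso_verts h) G"
    using F arcs by (auto simp: image_graph_def image_iff)
  then show ?R
    using h(1) by (auto simp: pre_digraph.digraph_isomorphism_def wf_digraph_with_proj_iff)
next
  assume ?R
  then show ?L
    unfolding digraph_iso_def
    by (metis isomorphism_vertex_map_iff app_iso_vertex_map)
qed

section \<open>Sparsity\<close>

text \<open>
  Every edge is counted by its two arcs, so for a graph this says that each subgraph has
  average degree at most \<open>r\<close>, without the division that \<^const>\<open>mad\<close> performs.
\<close>

definition sparse :: "real \<Rightarrow> 'a ugraph \<Rightarrow> bool" where
  "sparse r G \<longleftrightarrow> (\<forall>X\<subseteq>pverts G. real (card (parcs G \<inter> X \<times> X)) \<le> r * real (card X))"

lemma pair_graph_induced:
  assumes "pair_graph G" "X \<subseteq> pverts G"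
  shows "pair_graph (induced G X)"
  using assms unfolding pair_graph_iff
  by (auto simp: irrefl_def sym_def intro: finite_subset)

lemma finite_parcs: "pair_graph G \<Longrightarrow> finite (parcs G)"
  unfolding pair_graph_iff by (meson finite_SigmaI finite_subset)

lemma finite_edge_set:
  assumes "pair_graph G" shows "finite (edge_set G)"
proof -
  have "edge_set G = (\<lambda>(u, v). {u, v}) ` parcs G"
    by (auto simp: edge_set_def)
  then show ?thesis
    using finite_parcs[OF assms] by simp
qed

lemma card_parcs_le:
  assumes "pair_graph G" shows "card (parcs G) \<le> 2 * card (edge_set G)"
proof -
  let ?D = "\<lambda>e. {a \<in> parcs G. {fst a, snd a} = e}"
  have D: "card (?D e) \<le> 2" if e: "e \<in> edge_set G" for e
  proof -
    obtain u v where "e = {u, v}"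
      using e unfolding edge_set_def by blast
    then have "?D e \<subseteq> {(u, v), (v, u)}"
      by (auto simp: doubleton_eq_iff)
    then have "card (?D e) \<le> card {(u, v), (v, u)}"
      by (intro card_mono) auto
    also have "\<dots> \<le> 2"
      using card_length[of "[(u, v), (v, u)]"] by simp
    finally show ?thesis .
  qed
  have "{fst a, snd a} \<in> edge_set G" if "a \<in> parcs G" for a
    using that by (cases a) (auto simp: edge_set_def)
  then have "parcs G = (\<Union>e\<in>edge_set G. ?D e)"
    by blast
  then have "card (parcs G) = card (\<Union>e\<in>edge_set G. ?D e)"
    by (rule arg_cong)
  also have "\<dots> \<le> (\<Sum>e\<in>edge_set G. card (?D e))"
    by (rule card_UN_le[OF finite_edge_set[OF assms]])
  also have "\<dots> \<le> (\<Sum>e\<in>edge_set G. 2)"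
    using D by (rule sum_mono)
  finally show ?thesis
    by simp
qed

lemma sparse_mad:
  assumes G: "pair_graph G" and "mad G \<le> d"
  shows "sparse d G"
  unfolding sparse_def
proof (intro allI impI)
  fix X assume X: "X \<subseteq> pverts G"
  show "real (card (parcs G \<inter> X \<times> X)) \<le> d * real (card X)"
  proof (cases "X = {}")
    case False
    let ?sub = "\<lambda>G'. pair_graph G' \<and> subgraph (with_proj G') (with_proj G) \<and> card (pverts G') \<ge> 1"
    let ?M = "{2 * real (card (edge_set G')) / real (card (pverts G')) | G'. ?sub G'}"
    have finX: "finite X"
      using G X by (auto simp: pair_graph_iff intro: finite_subset)
    have "?M \<subseteq> (\<lambda>(V, A). 2 * real (card (edge_set \<lparr>pverts = V, parcs = A\<rparr>)) / real (card V))
            ` (Pow (pverts G) \<times> Pow (parcs G))"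
    proof
      fix x assume "x \<in> ?M"
      then obtain G' where "?sub G'" and
        x: "x = 2 * real (card (edge_set G')) / real (card (pverts G'))"
        by blast
      then have "(pverts G', parcs G') \<in> Pow (pverts G) \<times> Pow (parcs G)"
        by (auto simp: subgraph_with_proj_iff)
      then show "x \<in> (\<lambda>(V, A). 2 * real (card (edge_set \<lparr>pverts = V, parcs = A\<rparr>)) / real (card V))
            ` (Pow (pverts G) \<times> Pow (parcs G))"
        by (rule rev_image_eqI) (simp add: x edge_set_def)
    qed
    then have fin: "finite ?M"
      by (rule finite_subset) (use G finite_parcs[OF G] in \<open>auto simp: pair_graph_iff\<close>)
    have sub: "?sub (induced G X)"
      using False finX X G pair_graph_induced[OF G X]
      by (auto simp: subgraph_with_proj_iff pair_graph_iff Suc_le_eq card_gt_0_iff)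
    then have "2 * real (card (edge_set (induced G X))) / real (card (pverts (induced G X))) \<le> Max ?M"
      by (intro Max_ge fin) blast
    also have "\<dots> = mad G"
      using False X by (auto simp: mad_def)
    also have "\<dots> \<le> d" by fact
    finally have "2 * real (card (edge_set (induced G X))) \<le> d * real (card X)"
      using False finX by (simp add: field_simps card_gt_0_iff)
    moreover have "real (card (parcs (induced G X))) \<le> 2 * real (card (edge_set (induced G X)))"
      using card_parcs_le[OF pair_graph_induced[OF G X]] by linarith
    ultimately show ?thesis
      by simp
  qed simp
qed

text \<open>
  The arcs of \<open>H\<close> inside \<open>X\<close> lift to arcs of the guests inside the preimage of \<open>X\<close>. The
  preimage has at most \<open>k * card X\<close> vertices, so summing the sparsity of the guests over it
  loses only the factor \<open>k\<close>.
\<close>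

lemma sparse_covered:
  assumes guests: "\<And>i. i < t \<Longrightarrow> pair_graph (Gs i) \<and> sparse d (Gs i)"
    and cov: "parcs H \<subseteq> map_prod \<phi> \<phi> ` parcs (disj_union t Gs)"
    and fib: "fibres_bounded H t Gs \<phi> k" and fin: "finite (pverts H)" and d: "0 \<le> d"
  shows "sparse (d * real k) H"
  unfolding sparse_def
proof (intro allI impI)
  fix X assume X: "X \<subseteq> pverts H"
  let ?P = "\<lambda>i. {p \<in> pverts (Gs i). \<phi> (i, p) \<in> X}"
  let ?A = "\<lambda>i. parcs (Gs i) \<inter> ?P i \<times> ?P i"
  have finP: "finite (?P i)" if "i < t" for i
    using guests[OF that] by (auto simp: pair_graph_iff)
  have finA: "finite (?A i)" if "i < t" for i
    using finP[OF that] by blast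
  have "parcs H \<inter> X \<times> X \<subseteq> (\<Union>i<t. (\<lambda>(p, q). (\<phi> (i, p), \<phi> (i, q))) ` ?A i)"
  proof clarify
    fix u v assume uv: "(u, v) \<in> parcs H" "u \<in> X" "v \<in> X"
    then obtain i p q where i: "i < t" "(p, q) \<in> parcs (Gs i)" "u = \<phi> (i, p)" "v = \<phi> (i, q)"
      using cov by fastforce
    moreover have "p \<in> pverts (Gs i)" "q \<in> pverts (Gs i)"
      using guests[OF i(1)] i(2) by (auto simp: pair_graph_iff)
    ultimately show "(u, v) \<in> (\<Union>i<t. (\<lambda>(p, q). (\<phi> (i, p), \<phi> (i, q))) ` ?A i)"
      using uv by force
  qed
  then have "card (parcs H \<inter> X \<times> X) \<le> card (\<Union>i<t. (\<lambda>(p, q). (\<phi> (i, p), \<phi> (i, q))) ` ?A i)"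
    using finA by (intro card_mono finite_UN_I finite_imageI) auto
  also have "\<dots> \<le> (\<Sum>i<t. card ((\<lambda>(p, q). (\<phi> (i, p), \<phi> (i, q))) ` ?A i))"
    by (rule card_UN_le) simp
  also have "\<dots> \<le> (\<Sum>i<t. card (?A i))"
    using finA by (intro sum_mono card_image_le) auto
  finally have "real (card (parcs H \<inter> X \<times> X)) \<le> (\<Sum>i<t. real (card (?A i)))"
    unfolding of_nat_sum[symmetric] of_nat_le_iff .
  also have "\<dots> \<le> (\<Sum>i<t. d * real (card (?P i)))"
    using guests by (intro sum_mono) (auto simp: sparse_def)
  also have "\<dots> = d * real (card (SIGMA i:{..<t}. ?P i))"
    using finP by (subst card_SigmaI) (auto simp: sum_distrib_left)
  also have "\<dots> \<le> d * real (k * card X)"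
  proof -
    have "(SIGMA i:{..<t}. ?P i) = (\<Union>v\<in>X. {p \<in> pverts (disj_union t Gs). \<phi> p = v})"
      by auto
    also have "card \<dots> \<le> (\<Sum>v\<in>X. card {p \<in> pverts (disj_union t Gs). \<phi> p = v})"
      using fin X by (intro card_UN_le) (auto intro: finite_subset)
    also have "\<dots> \<le> (\<Sum>v\<in>X. k)"
      using fib X by (intro sum_mono) (auto simp: fibres_bounded_def)
    finally have "card (SIGMA i:{..<t}. ?P i) \<le> k * card X"
      by (simp add: mult.commute)
    then show ?thesis
      using d by (intro mult_left_mono of_nat_mono)
  qed
  finally show "real (card (parcs H \<inter> X \<times> X)) \<le> d * real k * real (card X)"
    by (simp add: mult.assoc)
qed

lemma sparse_low_degree:
  assumes "sparse r H" "X \<subseteq> pverts H" "X \<noteq> {}" "finite X"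
  shows "\<exists>v\<in>X. card {w \<in> X. (v, w) \<in> parcs H} \<le> nat \<lfloor>r\<rfloor>"
proof (rule ccontr)
  assume "\<not> ?thesis"
  then have large: "r < real (card {w \<in> X. (v, w) \<in> parcs H})" if "v \<in> X" for v
    using that by (metis le_nat_floor linorder_not_le)
  have "r * real (card X) < (\<Sum>v\<in>X. real (card {w \<in> X. (v, w) \<in> parcs H}))"
    using sum_strict_mono[of X "\<lambda>_. r"] large assms(3,4) by (simp add: mult.commute)
  also have "\<dots> = real (card (SIGMA v:X. {w \<in> X. (v, w) \<in> parcs H}))"
    using assms(4) by (subst card_SigmaI) auto
  also have "(SIGMA v:X. {w \<in> X. (v, w) \<in> parcs H}) = parcs H \<inter> X \<times> X"
    by auto
  finally show False
    using assms(1,2) by (auto simp: sparse_def)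
qed

section \<open>Colouring a degenerate graph by stars\<close>

text \<open>
  Removing a vertex of small degree and placing it last, recursively, orders the vertices so
  that each has few neighbours before it.
\<close>

lemma degenerate_rank:
  assumes "finite V"
    and "\<And>X. X \<subseteq> V \<Longrightarrow> X \<noteq> {} \<Longrightarrow> \<exists>v\<in>X. card {w \<in> X. (v, w) \<in> E} \<le> m"
  shows "\<exists>r :: 'a \<Rightarrow> nat. inj_on r V \<and> (\<forall>v\<in>V. card {w \<in> V. (v, w) \<in> E \<and> r w < r v} \<le> m)"
  using assms
proof (induction V rule: finite_psubset_induct)
  case (psubset V)
  show ?case
  proof (cases "V = {}")
    case False
    then obtain v where v: "v \<in> V" "card {w \<in> V. (v, w) \<in> E} \<le> m"
      using psubset.prems by blast
    have "\<exists>r :: 'a \<Rightarrow> nat. inj_on r (V - {v}) \<and>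
        (\<forall>u\<in>V - {v}. card {w \<in> V - {v}. (u, w) \<in> E \<and> r w < r u} \<le> m)"
    proof (rule psubset.IH)
      show "\<exists>v\<in>X. card {w \<in> X. (v, w) \<in> E} \<le> m" if "X \<subseteq> V - {v}" "X \<noteq> {}" for X
        using that by (intro psubset.prems) auto
    qed (use v(1) in blast)
    then obtain r :: "'a \<Rightarrow> nat" where r: "inj_on r (V - {v})"
      "\<And>u. u \<in> V - {v} \<Longrightarrow> card {w \<in> V - {v}. (u, w) \<in> E \<and> r w < r u} \<le> m"
      by blast
    obtain N where N: "\<And>u. u \<in> V \<Longrightarrow> r u < N"
      using finite_imageI[OF psubset.hyps, of r] unfolding finite_nat_set_iff_bounded by blast
    let ?r = "r(v := N)"
    have "inj_on ?r V"
      using r(1) N by (fastforce simp: inj_on_def)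
    moreover have "card {w \<in> V. (u, w) \<in> E \<and> ?r w < ?r u} \<le> m" if u: "u \<in> V" for u
    proof (cases "u = v")
      case True
      have "card {w \<in> V. (u, w) \<in> E \<and> ?r w < ?r u} \<le> card {w \<in> V. (v, w) \<in> E}"
        using True psubset.hyps by (intro card_mono) auto
      then show ?thesis
        using v(2) by simp
    next
      case False
      then have "{w \<in> V. (u, w) \<in> E \<and> ?r w < ?r u} = {w \<in> V - {v}. (u, w) \<in> E \<and> r w < r u}"
        using N[OF u] by auto
      then show ?thesis
        using r(2) u False by simp
    qed
    ultimately show ?thesis
      by blast
  qed auto
qed

text \<open>
  Greedy colouring of a conflict relation: if every nonempty subset has an element with fewer
  than \<open>q\<close> conflicts in it, that element can be coloured last.
\<close>

lemma greedy_colouring: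
  assumes "finite A" and R: "symp R"
    and "\<And>B. B \<subseteq> A \<Longrightarrow> B \<noteq> {} \<Longrightarrow> \<exists>a\<in>B. card {b \<in> B. b \<noteq> a \<and> R a b} < q"
  shows "\<exists>c :: 'a \<Rightarrow> nat. (\<forall>a\<in>A. c a < q) \<and> (\<forall>a\<in>A. \<forall>b\<in>A. a \<noteq> b \<and> R a b \<longrightarrow> c a \<noteq> c b)"
  using assms(1,3)
proof (induction A rule: finite_psubset_induct)
  case (psubset A)
  show ?case
  proof (cases "A = {}")
    case False
    then obtain a where a: "a \<in> A" "card {b \<in> A. b \<noteq> a \<and> R a b} < q"
      using psubset.prems by blast
    have "\<exists>c :: 'a \<Rightarrow> nat. (\<forall>b\<in>A - {a}. c b < q) \<and>
        (\<forall>b\<in>A - {a}. \<forall>b'\<in>A - {a}. b \<noteq> b' \<and> R b b' \<longrightarrow> c b \<noteq> c b')"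
    proof (rule psubset.IH)
      show "\<exists>a\<in>B. card {b \<in> B. b \<noteq> a \<and> R a b} < q" if "B \<subseteq> A - {a}" "B \<noteq> {}" for B
        using that by (intro psubset.prems) auto
    qed (use a(1) in blast)
    then obtain c :: "'a \<Rightarrow> nat" where c: "\<forall>b\<in>A - {a}. c b < q"
      "\<forall>b\<in>A - {a}. \<forall>b'\<in>A - {a}. b \<noteq> b' \<and> R b b' \<longrightarrow> c b \<noteq> c b'"
      by blast
    have "card (c ` {b \<in> A. b \<noteq> a \<and> R a b}) < card {..<q}"
      using a(2) psubset.hyps by (auto intro: le_less_trans[OF card_image_le])
    then have "\<not> {..<q} \<subseteq> c ` {b \<in> A. b \<noteq> a \<and> R a b}"
      using card_mono[of "c ` {b \<in> A. b \<noteq> a \<and> R a b}" "{..<q}"] psubset.hyps by auto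
    then obtain x where x: "x < q" "x \<notin> c ` {b \<in> A. b \<noteq> a \<and> R a b}"
      by blast
    have "\<forall>b\<in>A. (c(a := x)) b < q"
      using c(1) x(1) by simp
    moreover have "(c(a := x)) b \<noteq> (c(a := x)) b'"
      if "b \<in> A" "b' \<in> A" "b \<noteq> b'" "R b b'" for b b'
      using that x(2) c(2) sympD[OF R that(4)] by (auto simp: image_iff)
    ultimately show ?thesis
      by blast
  qed auto
qed

lemma finite_has_max:
  fixes r :: "'a \<Rightarrow> nat"
  assumes "finite X" "X \<noteq> {}"
  obtains x where "x \<in> X" "\<And>y. y \<in> X \<Longrightarrow> r y \<le> r x"
proof -
  have "Max (r ` X) \<in> r ` X"
    using assms by simp
  then obtain x where "x \<in> X" "r x = Max (r ` X)"
    by auto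
  then show thesis
    using assms(1) by (auto intro: that)
qed

text \<open>
  The combinatorial core. Orient every edge towards its earlier end in a degeneracy order, so
  that out-degrees are at most \<open>m\<close>. The three conditions on the colouring say that in each
  colour the arcs form stars pointing to their centres: a vertex has at most one out-arc, a head
  is not also a tail, and two leaves of one star are not adjacent. The last condition makes
  the stars induced.

  Why \<open>2 * m\<close> colours are enough: colour the arcs in lexicographic order of the ranks of tail
  and head. An arc \<open>(v, w)\<close> then conflicts with earlier arcs of three kinds: the out-arcs
  of \<open>w\<close>, at most \<open>m\<close> in number; the arcs \<open>(v, x)\<close> with \<open>x\<close> before \<open>w\<close>; and the arcs \<open>(x, w)\<close>
  with \<open>x\<close> a neighbour of \<open>v\<close> strictly between \<open>w\<close> and \<open>v\<close>. In the last two kinds, \<open>x\<close> is an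
  out-neighbour of \<open>v\<close> other than \<open>w\<close>, and each such \<open>x\<close> occurs in only one of them. Hence there
  are at most \<open>m + (m - 1)\<close> conflicts.
\<close>

lemma induced_star_colouring:
  fixes E :: "'a rel"
  assumes V: "finite V" "E \<subseteq> V \<times> V" and E: "sym E" "irrefl E"
    and deg: "\<And>X. X \<subseteq> V \<Longrightarrow> X \<noteq> {} \<Longrightarrow> \<exists>v\<in>X. card {w \<in> X. (v, w) \<in> E} \<le> m"
  obtains A and c :: "'a \<times> 'a \<Rightarrow> nat" where
    "A \<subseteq> E" "E \<subseteq> A \<union> A\<inverse>" "\<And>e. e \<in> A \<Longrightarrow> c e < 2 * m"
    "\<And>v w w'. (v, w) \<in> A \<Longrightarrow> (v, w') \<in> A \<Longrightarrow> c (v, w) = c (v, w') \<Longrightarrow> w = w'"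
    "\<And>v w x. (v, w) \<in> A \<Longrightarrow> (w, x) \<in> A \<Longrightarrow> c (v, w) \<noteq> c (w, x)"
    "\<And>v v' w. (v, w) \<in> A \<Longrightarrow> (v', w) \<in> A \<Longrightarrow> (v, v') \<in> E \<Longrightarrow> c (v, w) \<noteq> c (v', w)"
proof -
  obtain r :: "'a \<Rightarrow> nat" where r: "inj_on r V"
    and few: "\<And>v. v \<in> V \<Longrightarrow> card {w \<in> V. (v, w) \<in> E \<and> r w < r v} \<le> m"
    using degenerate_rank[OF V(1) deg] by blast
  define A where "A = {(v, w) \<in> E. r w < r v}"
  let ?out = "\<lambda>v. {w. (v, w) \<in> A}"
  have fin: "finite A"
    unfolding A_def using V by (auto intro: finite_subset[where B = "V \<times> V"])
  have out_eq: "?out v = {w \<in> V. (v, w) \<in> E \<and> r w < r v}" for v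
    using V(2) by (auto simp: A_def)
  have out: "card (?out v) \<le> m" "finite (?out v)" if "v \<in> V" for v
    using few[OF that] V(1) by (auto simp: out_eq)
  define R where "R = (\<lambda>(v, w) (v', w'). v = v' \<or> w = v' \<or> w' = v \<or> w = w' \<and> (v, v') \<in> E)"
  have "symp R"
    using E(1) by (auto simp: R_def sym_def intro!: sympI)
  moreover have "\<exists>a\<in>B. card {b \<in> B. b \<noteq> a \<and> R a b} < 2 * m" if B: "B \<subseteq> A" "B \<noteq> {}" for B
  proof -
    have finB: "finite B"
      using B(1) fin by (rule finite_subset)
    \<comment> \<open>to colour an arc last, take a tail of maximal rank and then a head of maximal rank\<close>
    obtain v where v: "v \<in> fst ` B" "\<And>v'. v' \<in> fst ` B \<Longrightarrow> r v' \<le> r v"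
      using finite_has_max[of "fst ` B" r] finB B(2) by auto
    have "finite {w. (v, w) \<in> B}" "{w. (v, w) \<in> B} \<noteq> {}"
      using v(1) finite_subset[of "{w. (v, w) \<in> B}" "snd ` B"] finB by force+
    then obtain w where w: "(v, w) \<in> B" "\<And>w'. (v, w') \<in> B \<Longrightarrow> r w' \<le> r w"
      using finite_has_max[of "{w. (v, w) \<in> B}" r] by auto
    have vw: "v \<in> V" "w \<in> V" "(v, w) \<in> A"
      using w(1) B(1) V(2) by (auto simp: A_def)
    \<comment> \<open>the one conflicting arc that an out-neighbour \<open>x\<close> of \<open>v\<close> accounts for\<close>
    let ?h = "\<lambda>x. if r x < r w then (v, x) else (x, w)"
    have "{b \<in> B. b \<noteq> (v, w) \<and> R (v, w) b} \<subseteq> Pair w ` ?out w \<union> ?h ` (?out v - {w})"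
    proof
      fix b assume "b \<in> {b \<in> B. b \<noteq> (v, w) \<and> R (v, w) b}"
      then obtain v' w' where b: "(v', w') \<in> B" "R (v, w) (v', w')" "b = (v', w')"
        and ne: "(v', w') \<noteq> (v, w)"
        by (cases b) auto
      have bA: "(v', w') \<in> A" and v': "r v' \<le> r v"
        using b(1) B(1) v(2) by force+
      from b(2) consider "v' = v" | "v' = w" | "w' = v" | "w' = w" "(v, v') \<in> E"
        by (auto simp: R_def)
      then show "b \<in> Pair w ` ?out w \<union> ?h ` (?out v - {w})"
      proof cases
        case 1
        have "r w' \<noteq> r w"
          using inj_onD[OF r, of w' w] ne 1 bA vw V(2) by (auto simp: A_def)
        then have "r w' < r w"
          using w(2) b(1) 1 by (simp add: nat_less_le)
        then have "(v', w') \<in> ?h ` (?out v - {w})"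
          using 1 bA ne by (intro image_eqI[of _ _ w']) auto
        then show ?thesis
          unfolding b(3) by (rule UnI2)
      next
        case 2
        then show ?thesis
          using bA b(3) by auto
      next
        case 3
        then show ?thesis
          using bA v' by (auto simp: A_def)
      next
        case 4
        have "v' \<noteq> v" "v' \<in> V" "r w < r v'"
          using ne 4 bA V(2) by (auto simp: A_def)
        moreover from this have "r v' < r v"
          using v' inj_onD[OF r, of v' v] vw(1) by (cases "r v' = r v") auto
        ultimately have "(v', w') \<in> ?h ` (?out v - {w})"
          using 4 by (intro image_eqI[of _ _ v']) (auto simp: A_def)
        then show ?thesis
          unfolding b(3) by (rule UnI2)
      qed
    qed
    then have "card {b \<in> B. b \<noteq> (v, w) \<and> R (v, w) b}
        \<le> card (Pair w ` ?out w \<union> ?h ` (?out v - {w}))"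
      using out(2)[OF vw(1)] out(2)[OF vw(2)] by (intro card_mono) auto
    also have "\<dots> \<le> card (Pair w ` ?out w) + card (?h ` (?out v - {w}))"
      by (rule card_Un_le)
    also have "\<dots> \<le> card (?out w) + card (?out v - {w})"
      using out(2)[OF vw(1)] out(2)[OF vw(2)] by (intro add_mono card_image_le) auto
    also have "\<dots> < 2 * m"
    proof -
      have "card (?out v - {w}) < card (?out v)"
        using vw out(2)[OF vw(1)] by (intro card_Diff1_less) auto
      then show ?thesis
        using out(1)[OF vw(1)] out(1)[OF vw(2)] by linarith
    qed
    finally show ?thesis
      using w(1) by blast
  qed
  ultimately obtain c :: "'a \<times> 'a \<Rightarrow> nat" where c: "\<And>a. a \<in> A \<Longrightarrow> c a < 2 * m"
    "\<And>a b. a \<in> A \<Longrightarrow> b \<in> A \<Longrightarrow> a \<noteq> b \<Longrightarrow> R a b \<Longrightarrow> c a \<noteq> c b"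
    using greedy_colouring[OF fin, of R "2 * m"] by blast
  show thesis
  proof (rule that[of A c])
    show "E \<subseteq> A \<union> A\<inverse>"
    proof (rule subrelI)
      fix u v assume uv: "(u, v) \<in> E"
      then have "u \<noteq> v" "u \<in> V" "v \<in> V" "(v, u) \<in> E"
        using E V(2) by (auto simp: irrefl_def sym_def)
      then have "r u \<noteq> r v"
        using inj_onD[OF r] by blast
      then show "(u, v) \<in> A \<union> A\<inverse>"
        using uv \<open>(v, u) \<in> E\<close> by (auto simp: A_def)
    qed
    show "w = w'" if "(v, w) \<in> A" "(v, w') \<in> A" "c (v, w) = c (v, w')" for v w w'
      using c(2)[OF that(1,2)] that(3) by (auto simp: R_def)
    show "c (v, w) \<noteq> c (w, x)" if "(v, w) \<in> A" "(w, x) \<in> A" for v w x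
      using c(2)[OF that] that by (auto simp: R_def A_def)
    show "c (v, w) \<noteq> c (v', w)" if "(v, w) \<in> A" "(v', w) \<in> A" "(v, v') \<in> E" for v v' w
      using c(2)[OF that(1,2)] that(3) E(2) by (auto simp: R_def irrefl_def)
  qed (use c(1) in \<open>auto simp: A_def\<close>)
qed

section \<open>Star systems\<close>

text \<open>
  What the colouring yields for a cover of \<open>H\<close>: in guest \<open>i\<close> and colour \<open>j < N\<close>, the set
  \<open>S i j q\<close> is meant to be the vertex set of a star with centre \<open>q\<close>, or empty. The stars of one colour are
  disjoint in each guest. Each of them is mapped isomorphically to an induced subgraph of \<open>H\<close>, and
  together their images contain all edges of \<open>H\<close>. Local and folded covers are refined
  by taking every star as a guest, union covers by joining all stars of one colour in one guest.
\<close>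

locale star_system =
  fixes H :: "'a ugraph" and t N :: nat and Gs :: "nat \<Rightarrow> 'g ugraph"
    and \<phi> :: "nat \<times> 'g \<Rightarrow> 'a" and S :: "nat \<Rightarrow> nat \<Rightarrow> 'g \<Rightarrow> 'g set"
  assumes host: "pair_graph H"
    and guests: "\<And>i. i < t \<Longrightarrow> pair_graph (Gs i)"
    and hom: "graph_hom \<phi> (disj_union t Gs) H"
    and star_verts: "\<And>i j q. i < t \<Longrightarrow> S i j q \<subseteq> pverts (Gs i)"
    and star_centre: "\<And>i j p q. i < t \<Longrightarrow> p \<in> S i j q \<Longrightarrow> p = q \<or> (q, p) \<in> parcs (Gs i)"
    and star_inj: "\<And>i j q. i < t \<Longrightarrow> inj_on (\<lambda>p. \<phi> (i, p)) (S i j q)"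
    and star_induced: "\<And>i j p p' q. i < t \<Longrightarrow> p \<in> S i j q \<Longrightarrow> p' \<in> S i j q \<Longrightarrow>
          (\<phi> (i, p), \<phi> (i, p')) \<in> parcs H \<Longrightarrow> (p, p') \<in> parcs (Gs i)"
    and star_disjoint: "\<And>i j p q q'. i < t \<Longrightarrow> p \<in> S i j q \<Longrightarrow> p \<in> S i j q' \<Longrightarrow> q = q'"
    and star_cover: "\<And>u v. (u, v) \<in> parcs H \<Longrightarrow> \<exists>i<t. \<exists>j<N. \<exists>q. \<exists>p\<in>S i j q. \<exists>p'\<in>S i j q.
          (p, p') \<in> parcs (Gs i) \<and> \<phi> (i, p) = u \<and> \<phi> (i, p') = v"

text \<open>
  Every oriented arc of \<open>H\<close> is lifted to one chosen arc of one guest, and a star collects the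
  lifts of equal colour with the same head in the same guest. As only one lift is chosen, a
  non-injective cover is no obstacle: two leaves of one star with the same image would lift the
  same arc of \<open>H\<close>, and likewise a leaf cannot have two centres over the same vertex of \<open>H\<close>.
\<close>

lemma star_system_exists:
  fixes H :: "'a ugraph" and \<phi> :: "nat \<times> 'g \<Rightarrow> 'a"
  assumes H: "pair_graph H" and guests: "\<And>i. i < t \<Longrightarrow> pair_graph (Gs i)"
    and hom: "graph_hom \<phi> (disj_union t Gs) H"
    and cov: "parcs H \<subseteq> map_prod \<phi> \<phi> ` parcs (disj_union t Gs)"
    and sparse: "sparse r H"
  shows "\<exists>S. star_system H t (2 * nat \<lfloor>r\<rfloor>) Gs \<phi> S"
proof -
  note Hs = H[unfolded pair_graph_iff]
  have H': "finite (pverts H)" "parcs H \<subseteq> pverts H \<times> pverts H" "sym (parcs H)" "irrefl (parcs H)"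
    using Hs by blast+
  have low: "\<exists>v\<in>X. card {w \<in> X. (v, w) \<in> parcs H} \<le> nat \<lfloor>r\<rfloor>"
    if "X \<subseteq> pverts H" "X \<noteq> {}" for X
    using sparse_low_degree[OF sparse that] Hs that(1) finite_subset by blast
  obtain A and c :: "'a \<times> 'a \<Rightarrow> nat" where A: "A \<subseteq> parcs H" "parcs H \<subseteq> A \<union> A\<inverse>"
    and c: "\<And>e. e \<in> A \<Longrightarrow> c e < 2 * nat \<lfloor>r\<rfloor>"
    and out: "\<And>v w w'. (v, w) \<in> A \<Longrightarrow> (v, w') \<in> A \<Longrightarrow> c (v, w) = c (v, w') \<Longrightarrow> w = w'"
    and path: "\<And>v w x. (v, w) \<in> A \<Longrightarrow> (w, x) \<in> A \<Longrightarrow> c (v, w) \<noteq> c (w, x)"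
    and fork: "\<And>v v' w. (v, w) \<in> A \<Longrightarrow> (v', w) \<in> A \<Longrightarrow> (v, v') \<in> parcs H \<Longrightarrow> c (v, w) \<noteq> c (v', w)"
    by (rule induced_star_colouring[OF H' low], assumption, assumption, rule that)
  have "\<forall>e\<in>parcs H. \<exists>l. case l of (i, p, q) \<Rightarrow>
      i < t \<and> (p, q) \<in> parcs (Gs i) \<and> e = (\<phi> (i, p), \<phi> (i, q))"
    using cov by fastforce
  from bchoice[OF this] obtain lift where "\<forall>e\<in>parcs H. case lift e of (i, p, q) \<Rightarrow>
      i < t \<and> (p, q) \<in> parcs (Gs i) \<and> e = (\<phi> (i, p), \<phi> (i, q))" ..
  note lift = this[rule_format]
  define L where "L i j q = {p. (\<phi> (i, p), \<phi> (i, q)) \<in> A \<and> c (\<phi> (i, p), \<phi> (i, q)) = j \<and>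
      lift (\<phi> (i, p), \<phi> (i, q)) = (i, p, q)}" for i j q
  define S where "S i j q = (if L i j q = {} then {} else insert q (L i j q))" for i j q
  have L_arc: "(\<phi> (i, p), \<phi> (i, q)) \<in> A"
    and L_colour: "c (\<phi> (i, p), \<phi> (i, q)) = j"
    and L_lift: "lift (\<phi> (i, p), \<phi> (i, q)) = (i, p, q)" if "p \<in> L i j q" for i j p q
    using that by (simp_all add: L_def)
  have leaf: "(p, q) \<in> parcs (Gs i)" "(q, p) \<in> parcs (Gs i)" if "i < t" "p \<in> L i j q" for i j p q
    using lift[of "(\<phi> (i, p), \<phi> (i, q))"] that A(1) guests[OF that(1)]
    by (auto simp: L_def pair_graph_iff sym_def)
  have leaf_verts: "p \<in> pverts (Gs i)" "q \<in> pverts (Gs i)" if "i < t" "p \<in> L i j q" for i j p q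
    using leaf[OF that] guests[OF that(1)] by (auto simp: pair_graph_iff)
  have irr: "(u, u) \<notin> parcs H" for u
    using Hs by (auto simp: irrefl_def)
  have S: "p = q \<or> p \<in> L i j q" "L i j q \<noteq> {}" if "p \<in> S i j q" for i j p q
    using that by (auto simp: S_def split: if_splits)
  have "star_system H t (2 * nat \<lfloor>r\<rfloor>) Gs \<phi> S"
  proof (rule star_system.intro)
    show "pair_graph H" by (rule H)
    show "graph_hom \<phi> (disj_union t Gs) H" by (rule hom)
  next
    fix i assume i: "i < t"
    show "pair_graph (Gs i)" by (rule guests[OF i])
    fix j q
    show "S i j q \<subseteq> pverts (Gs i)"
      using leaf_verts[OF i] by (auto simp: S_def)
    show "inj_on (\<lambda>p. \<phi> (i, p)) (S i j q)"
    proof (rule inj_onI)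
      fix p p' assume p: "p \<in> S i j q" "p' \<in> S i j q" and eq: "\<phi> (i, p) = \<phi> (i, p')"
      have "p \<noteq> q \<or> p' \<notin> L i j q" "p' \<noteq> q \<or> p \<notin> L i j q"
        using L_arc[of p' i j q] L_arc[of p i j q] A(1) irr eq by auto
      then consider "p = p'" | "p \<in> L i j q" "p' \<in> L i j q"
        using S(1)[OF p(1)] S(1)[OF p(2)] by blast
      then show "p = p'"
      proof cases
        case 2
        then show ?thesis
          using L_lift[OF 2(1)] L_lift[OF 2(2)] unfolding eq by simp
      qed
    qed
    fix p assume p: "p \<in> S i j q"
    show "p = q \<or> (q, p) \<in> parcs (Gs i)"
      using S(1)[OF p] leaf(2)[OF i] by blast
    show "(p, p') \<in> parcs (Gs i)" if p': "p' \<in> S i j q" and E: "(\<phi> (i, p), \<phi> (i, p')) \<in> parcs H" for p'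
    proof -
      have "\<not> (p \<in> L i j q \<and> p' \<in> L i j q)"
        using fork[OF L_arc L_arc E] L_colour by metis
      moreover have "p \<noteq> p'"
        using E irr by auto
      ultimately show ?thesis
        using S(1)[OF p] S(1)[OF p'] leaf[OF i] by blast
    qed
    show "q = q'" if p': "p \<in> S i j q'" for q'
    proof -
      \<comment> \<open>a centre of a nonempty star is the head of an arc of colour \<open>j\<close>, so its image is not a tail in that colour\<close>
      have no: "\<not> (p = q1 \<and> p \<in> L i j q2)" if ne: "L i j q1 \<noteq> {}" for q1 q2
      proof
        obtain p1 where p1: "p1 \<in> L i j q1"
          using ne by blast
        assume "p = q1 \<and> p \<in> L i j q2"
        then show False
          using path[of "\<phi> (i, p1)" "\<phi> (i, p)" "\<phi> (i, q2)"] p1 L_arc L_colour by metis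
      qed
      consider "q = q'" | "p \<in> L i j q" "p \<in> L i j q'"
        using S[OF p] S[OF p'] no by blast
      then show ?thesis
      proof cases
        case 2
        then have "\<phi> (i, q) = \<phi> (i, q')"
          using out[OF L_arc L_arc] L_colour by metis
        then have "(i, p, q) = (i, p, q')"
          using L_lift[OF 2(1)] L_lift[OF 2(2)] by metis
        then show ?thesis
          by simp
      qed
    qed
  next
    fix u v assume uv: "(u, v) \<in> parcs H"
    have star: "\<exists>i<t. \<exists>j<2 * nat \<lfloor>r\<rfloor>. \<exists>q. \<exists>p\<in>S i j q. q \<in> S i j q \<and>
        (p, q) \<in> parcs (Gs i) \<and> (q, p) \<in> parcs (Gs i) \<and> \<phi> (i, p) = u \<and> \<phi> (i, q) = v"
      if uv: "(u, v) \<in> A" for u v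
    proof -
      obtain i p q where l: "lift (u, v) = (i, p, q)"
        by (cases "lift (u, v)")
      with lift[of "(u, v)"] uv A(1) have i: "i < t" "u = \<phi> (i, p)" "v = \<phi> (i, q)"
        by auto
      then have p: "p \<in> L i (c (u, v)) q"
        using l uv by (auto simp: L_def)
      then show ?thesis
        using i leaf[OF i(1) p] c[OF uv] by (auto simp: S_def)
    qed
    show "\<exists>i<t. \<exists>j<2 * nat \<lfloor>r\<rfloor>. \<exists>q. \<exists>p\<in>S i j q. \<exists>p'\<in>S i j q.
        (p, p') \<in> parcs (Gs i) \<and> \<phi> (i, p) = u \<and> \<phi> (i, p') = v"
      using uv A(2) star[of u v] star[of v u] by blast
  qed
  then show ?thesis
    by (rule exI[of _ S])
qed

section \<open>Refining a cover by stars\<close>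

lemma induced_subgraph_trans:
  "induced_subgraph C F \<Longrightarrow> induced_subgraph F H \<Longrightarrow> induced_subgraph C H"
  by (auto simp: induced_subgraph_def subgraph_def compatible_def)

lemma induced_imp_weak_induced:
  assumes "induced_subgraph F H"
  shows "weak_induced_subgraph F H"
  using assms induced_subgraph_trans
  by (auto simp: weak_induced_subgraph_def pre_digraph.sccs_def induced_subgraph_def[of F H])

context star_system
begin

lemma hom_verts: "i < t \<Longrightarrow> p \<in> pverts (Gs i) \<Longrightarrow> \<phi> (i, p) \<in> pverts H"
  using hom by (auto simp: graph_hom_def)

lemma hom_arcs: "i < t \<Longrightarrow> (p, q) \<in> parcs (Gs i) \<Longrightarrow> (\<phi> (i, p), \<phi> (i, q)) \<in> parcs H"
  using hom by (fastforce simp: graph_hom_def)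

lemma centre_in_verts:
  assumes "i < t" "p \<in> S i j q" shows "q \<in> pverts (Gs i)"
  using star_centre[OF assms] star_verts[OF assms(1), of j q] guests[OF assms(1)] assms(2)
  by (auto simp: pair_graph_iff)

lemma image_star:
  assumes "i < t"
  shows "image_graph (\<lambda>p. \<phi> (i, p)) (induced (Gs i) (S i j q)) =
    induced H ((\<lambda>p. \<phi> (i, p)) ` S i j q)"
  using star_induced[OF assms] hom_arcs[OF assms]
  by (force simp: image_graph_def induced_def)

text \<open>
  Since the stars of one colour are disjoint in each guest, a vertex of a guest belongs to
  at most \<open>N\<close> stars, one for each colour. This multiplies the size of the fibres by at most \<open>N\<close>.
\<close>

lemma induced_star_cover:
  assumes her: "hereditary \<G>" and G: "\<And>i. i < t \<Longrightarrow> Gs i \<in> \<G>"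
    and fib: "fibres_bounded H t Gs \<phi> k"
  shows "\<exists>t' Gs' \<phi>'. is_cover \<G> H t' Gs' \<phi>' \<and> injective_cover t' Gs' \<phi>' \<and>
    fibres_bounded H t' Gs' \<phi>' (N * k) \<and> weak_induced_cover H t' Gs' \<phi>'"
proof -
  let ?I = "SIGMA i:{..<t}. {..<N} \<times> pverts (Gs i)"
  have "finite ?I"
    using guests by (auto simp: pair_graph_iff)
  then obtain h where h: "bij_betw h {0..<card ?I} ?I"
    using ex_bij_betw_nat_finite by blast
  define t' where "t' = card ?I"
  define gi where "gi n = fst (h n)" for n
  define co where "co n = fst (snd (h n))" for n
  define ce where "ce n = snd (snd (h n))" for n
  define Gs' where "Gs' n = induced (Gs (gi n)) (S (gi n) (co n) (ce n))" for n
  define \<phi>' where "\<phi>' = (\<lambda>(n, p). \<phi> (gi n, p))"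
  have hn: "h n = (gi n, co n, ce n)" for n
    by (simp add: gi_def co_def ce_def)
  have idx: "gi n < t" "co n < N" "ce n \<in> pverts (Gs (gi n))" if "n < t'" for n
    using bij_betwE[OF h] that hn[of n] by (force simp: t'_def)+
  have ind: "induced_subgraph (with_proj (Gs' n)) (with_proj (Gs (gi n)))" if "n < t'" for n
    using star_verts[OF idx(1)[OF that]] guests[OF idx(1)[OF that]]
    by (auto simp: induced_subgraph_with_proj_iff Gs'_def pair_graph_iff)
  have "is_cover \<G> H t' Gs' \<phi>'"
    unfolding is_cover_def
  proof (intro conjI allI impI)
    show "Gs' n \<in> \<G>" if "n < t'" for n
      using her ind[OF that] G[OF idx(1)[OF that]] unfolding hereditary_def by blast
    show "graph_hom \<phi>' (disj_union t' Gs') H"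
      unfolding graph_hom_def
      using hom_verts[OF idx(1)] hom_arcs[OF idx(1)] star_verts[OF idx(1)]
      by (fastforce simp: \<phi>'_def Gs'_def)
    show "parcs H \<subseteq> map_prod \<phi>' \<phi>' ` parcs (disj_union t' Gs')"
    proof (rule subrelI)
      fix u v assume "(u, v) \<in> parcs H"
      then obtain i j q p p' where st: "i < t" "j < N" "p \<in> S i j q" "p' \<in> S i j q"
        "(p, p') \<in> parcs (Gs i)" "\<phi> (i, p) = u" "\<phi> (i, p') = v"
        using star_cover by blast
      then have "(i, j, q) \<in> ?I"
        using centre_in_verts by auto
      then have "(i, j, q) \<in> h ` {0..<t'}"
        unfolding t'_def bij_betw_imp_surj_on[OF h] .
      then obtain n where n: "n < t'" "h n = (i, j, q)"
        by auto
      then have "gi n = i" "co n = j" "ce n = q"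
        by (simp_all add: gi_def co_def ce_def)
      then have "((n, p), (n, p')) \<in> parcs (disj_union t' Gs')"
        using st n(1) by (simp add: Gs'_def)
      then show "(u, v) \<in> map_prod \<phi>' \<phi>' ` parcs (disj_union t' Gs')"
        using st(6,7) \<open>gi n = i\<close> by (force simp: \<phi>'_def)
    qed
  qed
  moreover have "injective_cover t' Gs' \<phi>'"
    using star_inj[OF idx(1)]
    by (auto simp: injective_cover_def isomorphism_vertex_map_iff \<phi>'_def Gs'_def)
  moreover have "weak_induced_cover H t' Gs' \<phi>'"
    unfolding weak_induced_cover_def
  proof (intro allI impI)
    fix n assume n: "n < t'"
    have "induced_subgraph (with_proj (image_graph (\<lambda>p. \<phi> (gi n, p)) (Gs' n))) (with_proj H)"
      unfolding Gs'_def image_star[OF idx(1)[OF n]] induced_subgraph_with_proj_iff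
      using host hom_verts[OF idx(1)[OF n]] star_verts[OF idx(1)[OF n]]
      by (auto simp: pair_graph_iff)
    then show "weak_induced_subgraph (app_iso (vertex_map (\<lambda>v. \<phi>' (n, v))) (with_proj (Gs' n)))
        (with_proj H)"
      by (simp add: app_iso_vertex_map \<phi>'_def induced_imp_weak_induced)
  qed
  moreover have "fibres_bounded H t' Gs' \<phi>' (N * k)"
    unfolding fibres_bounded_def
  proof
    fix v assume v: "v \<in> pverts H"
    let ?F' = "{p \<in> pverts (disj_union t' Gs'). \<phi>' p = v}"
    let ?F = "{p \<in> pverts (disj_union t Gs). \<phi> p = v}"
    let ?g = "\<lambda>(n, p). (co n, (gi n, p))"
    have "finite (pverts (disj_union t Gs))"
      using guests by (auto simp: pair_graph_iff)
    then have "finite ?F"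
      by simp
    moreover have "inj_on ?g ?F'"
    proof (rule inj_onI)
      fix x y assume xy: "x \<in> ?F'" "y \<in> ?F'" "?g x = ?g y"
      obtain n p m where x: "x = (n, p)" and y: "y = (m, p)"
        using xy(3) by (cases x; cases y) auto
      have nm: "n < t'" "m < t'" "p \<in> S (gi n) (co n) (ce n)" "p \<in> S (gi m) (co m) (ce m)"
        "gi m = gi n" "co m = co n"
        using xy x y by (auto simp: Gs'_def)
      then have "ce n = ce m"
        using star_disjoint idx(1) by metis
      then have "h n = h m"
        using nm(5,6) hn[of n] hn[of m] by simp
      then show "x = y"
        using nm(1,2) inj_onD[OF bij_betw_imp_inj_on[OF h]] x y by (simp add: t'_def)
    qed
    moreover have "?g ` ?F' \<subseteq> {..<N} \<times> ?F"
      using idx(1,2) star_verts by (fastforce simp: Gs'_def \<phi>'_def)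
    ultimately have "card ?F' \<le> card ({..<N} \<times> ?F)"
      by (intro card_inj_on_le) auto
    also have "\<dots> \<le> N * k"
      using fib v by (auto simp: fibres_bounded_def card_cartesian_product)
    finally show "card ?F' \<le> N * k" .
  qed
  ultimately show ?thesis
    by blast
qed

text \<open>
  For each colour, the stars of a guest are joined without the edges that the guest may have
  between different stars. So a star forest need not be an induced subgraph of the guest.
\<close>

definition star_forest :: "nat \<Rightarrow> nat \<Rightarrow> 'g ugraph" where
  "star_forest i j = \<lparr> pverts = (\<Union>q. S i j q),
     parcs = (\<Union>q. parcs (Gs i) \<inter> S i j q \<times> S i j q) \<rparr>"

lemma star_forest_simps [simp]:
  "pverts (star_forest i j) = (\<Union>q. S i j q)"
  "parcs (star_forest i j) = (\<Union>q. parcs (Gs i) \<inter> S i j q \<times> S i j q)"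
  by (simp_all add: star_forest_def)

text \<open>
  Here injectivity on the whole guest is essential: otherwise the images of two disjoint stars
  could meet and merge into one component.
\<close>

lemma component_in_star:
  assumes i: "i < t" and inj: "inj_on (\<lambda>p. \<phi> (i, p)) (pverts (Gs i))"
    and C: "induced_subgraph C (with_proj (image_graph (\<lambda>p. \<phi> (i, p)) (star_forest i j)))"
      "strongly_connected C"
  shows "\<exists>q. verts C \<subseteq> (\<lambda>p. \<phi> (i, p)) ` S i j q"
proof -
  let ?f = "\<lambda>p. \<phi> (i, p)"
  have ends: "arcs_ends C = arcs C" and
    sub: "verts C \<subseteq> ?f ` (\<Union>q. S i j q)"
      "arcs C \<subseteq> map_prod ?f ?f ` (\<Union>q. parcs (Gs i) \<inter> S i j q \<times> S i j q)"
    using C(1) by (auto simp: induced_subgraph_def subgraph_def compatible_def arcs_ends_def arc_to_ends_def)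
  obtain u where u: "u \<in> verts C"
    using C(2) by (auto simp: strongly_connected_def)
  then obtain q where q: "u \<in> ?f ` S i j q"
    using sub(1) by blast
  have step: "y \<in> ?f ` S i j q" if xy: "x \<in> ?f ` S i j q" "(x, y) \<in> arcs C" for x y
  proof -
    obtain q' p p' where p: "p \<in> S i j q'" "p' \<in> S i j q'" "x = ?f p" "y = ?f p'"
      using xy(2) sub(2) by auto
    obtain p0 where p0: "p0 \<in> S i j q" "x = ?f p0"
      using xy(1) by auto
    have "p = p0"
      using inj_onD[OF inj, of p p0] p p0 star_verts[OF i] by auto
    then have "q = q'"
      using star_disjoint[OF i] p p0 by blast
    then show ?thesis
      using p by auto
  qed
  have "v \<in> ?f ` S i j q" if "v \<in> verts C" for v
  proof -
    have "u \<rightarrow>\<^sup>*\<^bsub>C\<^esub> v"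
      using C(2) u that by (auto simp: strongly_connected_def)
    then show ?thesis
      unfolding reachable_def
      by (induction rule: rtrancl_on_induct) (use q step ends in auto)
  qed
  then show ?thesis
    by blast
qed

lemma image_star_forest_weak_induced:
  assumes i: "i < t" and inj: "inj_on (\<lambda>p. \<phi> (i, p)) (pverts (Gs i))"
  shows "weak_induced_subgraph (with_proj (image_graph (\<lambda>p. \<phi> (i, p)) (star_forest i j))) (with_proj H)"
    (is "weak_induced_subgraph ?F _")
  unfolding weak_induced_subgraph_def
proof (intro conjI ballI)
  let ?f = "\<lambda>p. \<phi> (i, p)"
  show sub: "subgraph ?F (with_proj H)"
    using hom_verts[OF i] hom_arcs[OF i] star_verts[OF i] host
    by (fastforce simp: subgraph_with_proj_iff pair_graph_iff)
  fix C assume "C \<in> pre_digraph.sccs ?F"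
  then have C: "induced_subgraph C ?F" "strongly_connected C"
    by (auto simp: pre_digraph.sccs_def)
  obtain q where q: "verts C \<subseteq> ?f ` S i j q"
    using component_in_star[OF i inj C] by blast
  have "(u, v) \<in> parcs (image_graph ?f (star_forest i j))"
    if uv: "(u, v) \<in> parcs H" "u \<in> verts C" "v \<in> verts C" for u v
  proof -
    obtain p p' where "p \<in> S i j q" "p' \<in> S i j q" "u = ?f p" "v = ?f p'"
      using uv q by blast
    moreover from this have "(p, p') \<in> parcs (Gs i)"
      using star_induced[OF i] uv(1) by blast
    ultimately show ?thesis
      by force
  qed
  then show "induced_subgraph C (with_proj H)"
    using C(1) sub
    by (fastforce simp: induced_subgraph_def subgraph_def compatible_def)
qed

end

section \<open>Disjoint unions of guests\<close>

lemma disj_union_closure_iff: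
  assumes "graph_class \<G>"
  shows "F \<in> disj_union_closure \<G> \<longleftrightarrow>
    (\<exists>t Gs f. (\<forall>i<t. Gs i \<in> \<G>) \<and> inj_on f (pverts (disj_union t Gs)) \<and>
       F = image_graph f (disj_union t Gs))"
proof -
  have "parcs (disj_union t Gs) \<subseteq> pverts (disj_union t Gs) \<times> pverts (disj_union t Gs)"
    if "\<forall>i<t. Gs i \<in> \<G>" for t and Gs :: "nat \<Rightarrow> nat ugraph"
    using assms that by (fastforce simp: graph_class_def pair_graph_iff)
  then show ?thesis
    unfolding disj_union_closure_def digraph_iso_with_proj_iff by blast
qed

lemma image_graph_in_class:
  fixes \<G> :: "'a ugraph set"
  assumes "graph_class \<G>" "G \<in> \<G>" "inj_on f (pverts G)"
  shows "image_graph f G \<in> \<G>"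
proof -
  have "digraph_iso (with_proj G) (with_proj (image_graph f G))"
    using assms by (auto simp: digraph_iso_with_proj_iff graph_class_def pair_graph_iff)
  then show ?thesis
    using assms(1,2) by (auto simp: graph_class_def)
qed

lemma pair_graph_disj_union:
  assumes "\<And>i. i < t \<Longrightarrow> pair_graph (Gs i)"
  shows "pair_graph (disj_union t Gs)"
  using assms by (fastforce simp: pair_graph_iff irrefl_def sym_def)

lemma pair_graph_image:
  assumes "pair_graph G" "inj_on f (pverts G)"
  shows "pair_graph (image_graph f G)"
proof -
  note G = assms(1)[unfolded pair_graph_iff]
  have "irrefl (parcs (image_graph f G))"
    using G inj_onD[OF assms(2)] by (fastforce simp: irrefl_def)
  moreover have "sym (parcs (image_graph f G))"
    using G by (fastforce simp: sym_def)
  ultimately show ?thesis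
    using G by (auto simp: pair_graph_iff)
qed

lemma pair_graph_closure:
  assumes G: "graph_class \<G>" and F: "F \<in> disj_union_closure \<G>"
  shows "pair_graph F"
proof -
  obtain t Gs f where "\<forall>i<t. Gs i \<in> \<G>" "inj_on f (pverts (disj_union t Gs))"
    "F = image_graph f (disj_union t Gs)"
    using F unfolding disj_union_closure_iff[OF G] by blast
  moreover from this have "pair_graph (disj_union t Gs)"
    using G by (intro pair_graph_disj_union) (simp add: graph_class_def)
  ultimately show ?thesis
    by (simp only: pair_graph_image)
qed

text \<open>
  A disjoint union is covered by its summands with fibres of size one.
\<close>

lemma sparse_closure:
  assumes G: "graph_class \<G>" and F: "F \<in> disj_union_closure \<G>"
    and d: "\<And>G. G \<in> \<G> \<Longrightarrow> sparse d G" "0 \<le> d"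
  shows "sparse d F"
proof -
  obtain t Gs f where Gs: "\<forall>i<t. Gs i \<in> \<G>" and f: "inj_on f (pverts (disj_union t Gs))"
    and F': "F = image_graph f (disj_union t Gs)"
    using F unfolding disj_union_closure_iff[OF G] by blast
  have "fibres_bounded F t Gs f 1"
    unfolding fibres_bounded_def
  proof
    fix v assume "v \<in> pverts F"
    then obtain p where "p \<in> pverts (disj_union t Gs)" "v = f p"
      unfolding F' by auto
    then have "{p \<in> pverts (disj_union t Gs). f p = v} = {p}"
      using inj_onD[OF f] by blast
    then show "card {p \<in> pverts (disj_union t Gs). f p = v} \<le> 1"
      by simp
  qed
  then have "sparse (d * real 1) F"
    using Gs G d pair_graph_closure[OF G F]
    by (intro sparse_covered[of t Gs]) (auto simp: F' graph_class_def pair_graph_iff)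
  then show ?thesis
    by simp
qed

text \<open>
  All vertices of \<open>X\<close> are equal or adjacent to \<open>q\<close>, hence lie in the summand that contains \<open>q\<close>,
  and heredity of the class applies to that summand.
\<close>

lemma star_in_class:
  assumes G: "graph_class \<G>" "hereditary \<G>" and F: "F \<in> disj_union_closure \<G>"
    and q: "q \<in> pverts F" and X: "X \<subseteq> pverts F" "\<And>p. p \<in> X \<Longrightarrow> p = q \<or> (q, p) \<in> parcs F"
  shows "induced F X \<in> \<G>"
proof -
  obtain t Gs f where Gs: "\<forall>i<t. Gs i \<in> \<G>" and f: "inj_on f (pverts (disj_union t Gs))"
    and F': "F = image_graph f (disj_union t Gs)"
    using F unfolding disj_union_closure_iff[OF G(1)] by blast
  have arcs: "parcs (Gs i) \<subseteq> pverts (Gs i) \<times> pverts (Gs i)" if "i < t" for i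
    using Gs G(1) that by (auto simp: graph_class_def pair_graph_iff)
  obtain s c where s: "s < t" "c \<in> pverts (Gs s)" "q = f (s, c)"
    using q by (auto simp: F')
  let ?g = "\<lambda>y. f (s, y)"
  define Y where "Y = {y \<in> pverts (Gs s). ?g y \<in> X}"
  have "p \<in> ?g ` Y" if "p \<in> X" for p
    using X(2)[OF that]
  proof
    assume "p = q"
    then show ?thesis
      using s that by (auto simp: Y_def)
  next
    assume "(q, p) \<in> parcs F"
    then obtain i u v where uv: "i < t" "(u, v) \<in> parcs (Gs i)" "q = f (i, u)" "p = f (i, v)"
      by (auto simp: F')
    then have "u \<in> pverts (Gs i)" "v \<in> pverts (Gs i)"
      using arcs by auto
    moreover from this have "(i, u) = (s, c)"
      using inj_onD[OF f] uv s by auto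
    ultimately show ?thesis
      using uv that by (auto simp: Y_def)
  qed
  then have X': "X = ?g ` Y"
    by (auto simp: Y_def)
  have "parcs F \<inter> X \<times> X = map_prod ?g ?g ` (parcs (Gs s) \<inter> Y \<times> Y)"
  proof (intro equalityI subsetI)
    fix e assume e: "e \<in> parcs F \<inter> X \<times> X"
    then obtain i u v where uv: "i < t" "(u, v) \<in> parcs (Gs i)" "e = (f (i, u), f (i, v))"
      by (auto simp: F')
    have "f (i, u) \<in> X" "f (i, v) \<in> X"
      using e uv(3) by auto
    then obtain y z where yz: "y \<in> Y" "z \<in> Y" "f (i, u) = ?g y" "f (i, v) = ?g z"
      unfolding X' by blast
    have "(i, u) = (s, y)" "(i, v) = (s, z)"
      using inj_onD[OF f yz(3)] inj_onD[OF f yz(4)] arcs[OF uv(1)] uv yz s(1) by (auto simp: Y_def)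
    then show "e \<in> map_prod ?g ?g ` (parcs (Gs s) \<inter> Y \<times> Y)"
      using uv yz by force
  next
    fix e assume "e \<in> map_prod ?g ?g ` (parcs (Gs s) \<inter> Y \<times> Y)"
    then show "e \<in> parcs F \<inter> X \<times> X"
      using s(1) unfolding F' X' by force
  qed
  then have "induced F X = image_graph ?g (induced (Gs s) Y)"
    using X' by (simp add: induced_def image_graph_def)
  moreover have "induced (Gs s) Y \<in> \<G>"
  proof -
    have "induced_subgraph (with_proj (induced (Gs s) Y)) (with_proj (Gs s))"
      using arcs[OF s(1)] by (auto simp: induced_subgraph_with_proj_iff Y_def)
    then show ?thesis
      using G(2) Gs s(1) unfolding hereditary_def by blast
  qed
  moreover have "inj_on ?g (pverts (induced (Gs s) Y))"
    using inj_onD[OF f] s(1) by (auto simp: inj_on_def Y_def)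
  ultimately show ?thesis
    using image_graph_in_class[OF G(1)] by metis
qed

lemma star_forest_in_closure:
  fixes \<phi> :: "nat \<times> nat \<Rightarrow> 'a"
  assumes "star_system H t N Gs \<phi> S" and G: "graph_class \<G>" "hereditary \<G>"
    and i: "i < t" and closure: "Gs i \<in> disj_union_closure \<G>"
  shows "star_system.star_forest Gs S i j \<in> disj_union_closure \<G>"
proof -
  interpret star_system H t N Gs \<phi> S by fact
  have "finite (pverts (Gs i))"
    using guests[OF i] by (simp add: pair_graph_iff)
  then obtain h where h: "bij_betw h {0..<card (pverts (Gs i))} (pverts (Gs i))"
    using ex_bij_betw_nat_finite by blast
  define n where "n = card (pverts (Gs i))"
  define St where "St k = induced (Gs i) (S i j (h k))" for k
  have hk: "h k \<in> pverts (Gs i)" if "k < n" for k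
    using bij_betwE[OF h] that by (auto simp: n_def)
  have hq: "\<exists>k<n. q = h k" if "p \<in> S i j q" for p q
  proof -
    have "q \<in> h ` {0..<n}"
      unfolding n_def bij_betw_imp_surj_on[OF h] by (rule centre_in_verts[OF i that])
    then show ?thesis
      by auto
  qed
  have "St k \<in> \<G>" if "k < n" for k
    unfolding St_def
    by (rule star_in_class[OF G closure hk[OF that] star_verts[OF i] star_centre[OF i]])
  moreover have "inj_on snd (pverts (disj_union n St))"
  proof (rule inj_onI)
    fix x y assume xy: "x \<in> pverts (disj_union n St)" "y \<in> pverts (disj_union n St)" "snd x = snd y"
    obtain k l p where kl: "x = (k, p)" "y = (l, p)" "k < n" "l < n" "p \<in> S i j (h k)" "p \<in> S i j (h l)"
      using xy by (cases x; cases y) (auto simp: St_def)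
    then have "h k = h l"
      using star_disjoint[OF i] by blast
    then show "x = y"
      using kl inj_onD[OF bij_betw_imp_inj_on[OF h]] by (simp add: n_def)
  qed
  moreover have "star_forest i j = image_graph snd (disj_union n St)"
  proof -
    have "pverts (star_forest i j) = snd ` pverts (disj_union n St)"
      using hq by (force simp: St_def)
    moreover have "parcs (star_forest i j) = map_prod snd snd ` parcs (disj_union n St)"
      using hq by (force simp: St_def)
    ultimately show ?thesis
      by (simp add: image_graph_def)
  qed
  ultimately show ?thesis
    unfolding disj_union_closure_iff[OF G(1)] by blast
qed

text \<open>
  The guest \<open>n = i * N + j\<close> is the star forest of colour \<open>j\<close> in the old guest \<open>i\<close>.
\<close>

lemma star_forest_cover:
  fixes \<phi> :: "nat \<times> nat \<Rightarrow> 'a"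
  assumes "star_system H t N Gs \<phi> S" and G: "graph_class \<G>" "hereditary \<G>"
    and closure: "\<And>i. i < t \<Longrightarrow> Gs i \<in> disj_union_closure \<G>"
    and inj: "\<And>i. i < t \<Longrightarrow> inj_on (\<lambda>p. \<phi> (i, p)) (pverts (Gs i))"
  shows "\<exists>Gs' \<phi>'. is_cover (disj_union_closure \<G>) H (t * N) Gs' \<phi>' \<and>
    injective_cover (t * N) Gs' \<phi>' \<and> weak_induced_cover H (t * N) Gs' \<phi>'"
proof -
  interpret star_system H t N Gs \<phi> S by fact
  define Gs' where "Gs' n = star_forest (n div N) (n mod N)" for n
  define \<phi>' where "\<phi>' = (\<lambda>(n, p). \<phi> (n div N, p))"
  have idx: "n div N < t" if "n < t * N" for n
    using that by (simp add: less_mult_imp_div_less)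
  have "is_cover (disj_union_closure \<G>) H (t * N) Gs' \<phi>'"
    unfolding is_cover_def
  proof (intro conjI allI impI)
    show "Gs' n \<in> disj_union_closure \<G>" if "n < t * N" for n
      unfolding Gs'_def
      using star_forest_in_closure[OF assms(1) G] idx[OF that] closure by blast
    show "graph_hom \<phi>' (disj_union (t * N) Gs') H"
      unfolding graph_hom_def
      using hom_verts[OF idx] hom_arcs[OF idx] star_verts[OF idx]
      by (fastforce simp: \<phi>'_def Gs'_def)
    show "parcs H \<subseteq> map_prod \<phi>' \<phi>' ` parcs (disj_union (t * N) Gs')"
    proof (rule subrelI)
      fix u v assume "(u, v) \<in> parcs H"
      then obtain i j q p p' where st: "i < t" "j < N" "p \<in> S i j q" "p' \<in> S i j q"
        "(p, p') \<in> parcs (Gs i)" "\<phi> (i, p) = u" "\<phi> (i, p') = v"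
        using star_cover by blast
      define n where "n = i * N + j"
      have n: "n div N = i" "n mod N = j"
        using st(2) by (auto simp: n_def)
      have "n < Suc i * N"
        using st(2) by (simp add: n_def)
      also have "\<dots> \<le> t * N"
        using st(1) by (intro mult_le_mono1) simp
      finally have "((n, p), (n, p')) \<in> parcs (disj_union (t * N) Gs')"
        using st n by (auto simp: Gs'_def)
      then show "(u, v) \<in> map_prod \<phi>' \<phi>' ` parcs (disj_union (t * N) Gs')"
        using st(6,7) n by (force simp: \<phi>'_def)
    qed
  qed
  moreover have "injective_cover (t * N) Gs' \<phi>'"
    unfolding injective_cover_def isomorphism_vertex_map_iff
  proof (intro allI impI conjI)
    fix n assume n: "n < t * N"
    show "parcs (Gs' n) \<subseteq> pverts (Gs' n) \<times> pverts (Gs' n)"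
      by (auto simp: Gs'_def)
    have "pverts (Gs' n) \<subseteq> pverts (Gs (n div N))"
      using star_verts[OF idx[OF n]] by (simp add: Gs'_def UN_subset_iff)
    then show "inj_on (\<lambda>v. \<phi>' (n, v)) (pverts (Gs' n))"
      unfolding \<phi>'_def prod.case by (rule inj_on_subset[OF inj[OF idx[OF n]]])
  qed
  moreover have "weak_induced_cover H (t * N) Gs' \<phi>'"
    using image_star_forest_weak_induced[OF idx inj[OF idx]]
    by (simp add: weak_induced_cover_def app_iso_vertex_map \<phi>'_def Gs'_def)
  ultimately show ?thesis
    by blast
qed

section \<open>Comparing the covering numbers\<close>

lemma Inf_enat_attained:
  fixes X :: "nat \<Rightarrow> bool"
  assumes "Inf {enat n | n. X n} = enat k"
  shows "X k"
proof -
  have "{enat n | n. X n} \<noteq> {}"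
  proof
    assume "{enat n | n. X n} = {}"
    then have "Inf {enat n | n. X n} = \<infinity>"
      unfolding Inf_enat_def by simp
    then show False
      using assms by simp
  qed
  then have "Inf {enat n | n. X n} \<in> {enat n | n. X n}"
    unfolding Inf_enat_def by (auto intro: LeastI)
  then show ?thesis
    using assms by auto
qed

lemma injective_coverD:
  "injective_cover t Gs \<phi> \<Longrightarrow> i < t \<Longrightarrow> inj_on (\<lambda>p. \<phi> (i, p)) (pverts (Gs i))"
  by (auto simp: injective_cover_def isomorphism_vertex_map_iff)

lemma fibres_bounded_injective_cover:
  assumes "injective_cover t Gs \<phi>"
  shows "fibres_bounded H t Gs \<phi> t"
  unfolding fibres_bounded_def
proof
  fix v
  let ?F = "{p \<in> pverts (disj_union t Gs). \<phi> p = v}"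
  have "inj_on fst ?F"
    using inj_onD[OF injective_coverD[OF assms]] by (auto simp: inj_on_def)
  then have "card ?F \<le> card {..<t}"
    by (rule card_inj_on_le) auto
  then show "card ?F \<le> t"
    by simp
qed

lemma covering_number_edgeless:
  assumes "parcs H = {}"
  shows "covering_number ind x \<G> H = 0"
proof -
  have empty: "is_cover \<K> H 0 Gs \<phi> \<and> injective_cover 0 Gs \<phi> \<and> fibres_bounded H 0 Gs \<phi> 0 \<and>
      weak_induced_cover H 0 Gs \<phi>" for \<K> and Gs :: "nat \<Rightarrow> nat ugraph" and \<phi>
    using assms by (simp add: is_cover_def graph_hom_def injective_cover_def fibres_bounded_def
        weak_induced_cover_def)
  have "covering_number ind x \<G> H \<le> enat 0"
    by (cases x; simp only: covering_number.simps; rule Inf_lower; use empty in blast)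
  then show ?thesis
    by (simp add: zero_enat_def[symmetric])
qed

lemma star_system_of_cover:
  assumes H: "pair_graph H" and cov: "is_cover \<K> H t Gs \<phi>" and fib: "fibres_bounded H t Gs \<phi> k"
    and K: "\<And>G. G \<in> \<K> \<Longrightarrow> pair_graph G" "\<And>G. G \<in> \<K> \<Longrightarrow> sparse d G" and d: "0 \<le> d"
  shows "\<exists>S. star_system H t (2 * nat \<lfloor>d * real k\<rfloor>) Gs \<phi> S"
proof (rule star_system_exists[OF H])
  show guests: "pair_graph (Gs i)" if "i < t" for i
    using cov K(1) that by (simp add: is_cover_def)
  show "graph_hom \<phi> (disj_union t Gs) H"
    and arcs: "parcs H \<subseteq> map_prod \<phi> \<phi> ` parcs (disj_union t Gs)"
    using cov unfolding is_cover_def by blast+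
  have "finite (pverts H)"
    using H by (simp add: pair_graph_iff)
  moreover have "sparse d (Gs i)" if "i < t" for i
    using cov K(2) that by (simp add: is_cover_def)
  ultimately show "sparse (d * real k) H"
    using sparse_covered[OF _ arcs fib _ d] guests by blast
qed

text \<open>
  Fibres of size \<open>k\<close> make the host \<open>d * k\<close>-sparse, and the refinement multiplies \<open>k\<close> by the
  number of colours. For the union number, the \<open>k\<close> guests themselves bound the fibres. An
  injective local cover and a folded cover are refined in the same way, since the refinement is
  injective anyway.
\<close>

lemma icov_le:
  assumes G: "graph_class \<G>" "hereditary \<G>" and H: "pair_graph H"
    and sparse: "\<And>G. G \<in> \<G> \<Longrightarrow> sparse d G" and d: "0 \<le> d"
    and k: "cov x \<G> H = enat k"
  shows "icov x \<G> H \<le> enat (2 * nat \<lfloor>d * real k\<rfloor> * k)"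
proof -
  have graphs: "G \<in> \<G> \<Longrightarrow> pair_graph G" for G
    using G(1) by (auto simp: graph_class_def)
  have refined: "\<exists>t' Gs' \<phi>'. is_cover \<G> H t' Gs' \<phi>' \<and> injective_cover t' Gs' \<phi>' \<and>
      fibres_bounded H t' Gs' \<phi>' (2 * nat \<lfloor>d * real k\<rfloor> * k) \<and> weak_induced_cover H t' Gs' \<phi>'"
    if c: "is_cover \<G> H t Gs \<phi>" "fibres_bounded H t Gs \<phi> k" for t Gs \<phi>
  proof -
    obtain S where "star_system H t (2 * nat \<lfloor>d * real k\<rfloor>) Gs \<phi> S"
      using star_system_of_cover[OF H c graphs sparse d] by blast
    moreover have "Gs i \<in> \<G>" if "i < t" for i
      using c(1) that by (simp add: is_cover_def)
    ultimately show ?thesis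
      using star_system.induced_star_cover[OF _ G(2) _ c(2)] by blast
  qed
  show ?thesis
  proof (cases x)
    case Union_cover
    obtain Gs \<phi> where c: "is_cover (disj_union_closure \<G>) H k Gs \<phi>" "injective_cover k Gs \<phi>"
      using Inf_enat_attained[OF k[unfolded Union_cover covering_number.simps]] by blast
    obtain S where st: "star_system H k (2 * nat \<lfloor>d * real k\<rfloor>) Gs \<phi> S"
      using star_system_of_cover[OF H c(1) fibres_bounded_injective_cover[OF c(2)]
          pair_graph_closure[OF G(1)] sparse_closure[OF G(1) _ sparse d] d] by blast
    have "Gs i \<in> disj_union_closure \<G>" if "i < k" for i
      using c(1) that by (simp add: is_cover_def)
    then have "\<exists>Gs' \<phi>'. is_cover (disj_union_closure \<G>) H (k * (2 * nat \<lfloor>d * real k\<rfloor>)) Gs' \<phi>' \<and>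
        injective_cover (k * (2 * nat \<lfloor>d * real k\<rfloor>)) Gs' \<phi>' \<and>
        weak_induced_cover H (k * (2 * nat \<lfloor>d * real k\<rfloor>)) Gs' \<phi>'"
      by (rule star_forest_cover[OF st G _ injective_coverD[OF c(2)]])
    then show ?thesis
      unfolding Union_cover covering_number.simps mult.commute[of _ k] by (intro Inf_lower) blast
  next
    case Local_cover
    obtain t Gs \<phi> where "is_cover \<G> H t Gs \<phi>" "fibres_bounded H t Gs \<phi> k"
      using Inf_enat_attained[OF k[unfolded Local_cover covering_number.simps]] by blast
    then show ?thesis
      unfolding Local_cover covering_number.simps by (intro Inf_lower) (use refined in blast)
  next
    case Folded_cover
    obtain t Gs \<phi> where "is_cover \<G> H t Gs \<phi>" "fibres_bounded H t Gs \<phi> k"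
      using Inf_enat_attained[OF k[unfolded Folded_cover covering_number.simps]] by blast
    then show ?thesis
      unfolding Folded_cover covering_number.simps by (intro Inf_lower) (use refined in blast)
  qed
qed

text \<open>
  This serves to show that \<open>d\<close> is nonnegative as soon as the host has an edge: for an empty class,
  \<open>d\<close> could be any real number.
\<close>

lemma edgeless_of_edgeless_guests:
  assumes G: "graph_class \<G>" and no: "\<And>G. G \<in> \<G> \<Longrightarrow> parcs G = {}"
    and k: "cov x \<G> H = enat k"
  shows "parcs H = {}"
proof -
  have closure: "parcs F = {}" if "F \<in> disj_union_closure \<G>" for F
    using that no unfolding disj_union_closure_iff[OF G] by fastforce
  have edgeless: "parcs H = {}" if "is_cover \<K> H t Gs \<phi>" "\<And>G. G \<in> \<K> \<Longrightarrow> parcs G = {}"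
    for \<K> t and Gs :: "nat \<Rightarrow> nat ugraph" and \<phi>
    using that by (fastforce simp: is_cover_def)
  show ?thesis
  proof (cases x)
    case Union_cover
    then show ?thesis
      using Inf_enat_attained[OF k[unfolded Union_cover covering_number.simps]] edgeless closure
      by blast
  next
    case Local_cover
    then show ?thesis
      using Inf_enat_attained[OF k[unfolded Local_cover covering_number.simps]] edgeless no
      by blast
  next
    case Folded_cover
    then show ?thesis
      using Inf_enat_attained[OF k[unfolded Folded_cover covering_number.simps]] edgeless no
      by blast
  qed
qed

lemma icov_bound:
  fixes d :: real
  assumes G: "graph_class \<G>" "hereditary \<G>" and mad: "mad_class \<G> \<le> ereal d"
    and H: "pair_graph H" and k: "cov x \<G> H = enat k"
  shows "\<exists>n. icov x \<G> H = enat n \<and> real n \<le> 2 * d * (real k)\<^sup>2"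
proof (cases "parcs H = {}")
  case True
  then have "icov x \<G> H = enat 0" "k = 0"
    using covering_number_edgeless[OF True] k by (simp_all add: zero_enat_def)
  then show ?thesis
    by simp
next
  case False
  have sparse: "sparse d G" if "G \<in> \<G>" for G
  proof (rule sparse_mad)
    show "pair_graph G"
      using that G(1) by (simp add: graph_class_def)
    have "ereal (mad G) \<le> mad_class \<G>"
      unfolding mad_class_def using that by (rule SUP_upper)
    then show "mad G \<le> d"
      using mad order_trans by fastforce
  qed
  obtain G where G': "G \<in> \<G>" "parcs G \<noteq> {}"
    using edgeless_of_edgeless_guests[OF G(1) _ k] False by blast
  have "pair_graph G"
    using G'(1) G(1) by (simp add: graph_class_def)
  then have "0 < card (parcs G)" "parcs G \<inter> pverts G \<times> pverts G = parcs G"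
    using G'(2) finite_parcs by (auto simp: card_gt_0_iff pair_graph_iff)
  then have "0 < d * real (card (pverts G))"
    using sparse[OF G'(1)] unfolding sparse_def by (metis of_nat_0_less_iff order_refl order_less_le_trans)
  then have d: "0 \<le> d"
    by (simp add: zero_less_mult_iff)
  have "icov x \<G> H \<le> enat (2 * nat \<lfloor>d * real k\<rfloor> * k)"
    using icov_le[OF G H sparse d k] .
  then obtain n where n: "icov x \<G> H = enat n" "n \<le> 2 * nat \<lfloor>d * real k\<rfloor> * k"
    by (metis enat_ile enat_ord_simps(1))
  have "real n \<le> 2 * real (nat \<lfloor>d * real k\<rfloor>) * real k"
    using n(2) by (metis of_nat_le_iff of_nat_mult of_nat_numeral)
  also have "\<dots> \<le> 2 * (d * real k) * real k"
    using d by (intro mult_right_mono mult_left_mono of_nat_floor) auto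
  finally show ?thesis
    using n(1) by (auto simp: power2_eq_square mult.assoc)
qed

theorem corollary14:
  fixes \<G> :: "nat ugraph set" and d :: real
  assumes "graph_class \<G>" and "hereditary \<G>" and "mad_class \<G> \<le> ereal d"
  shows "(\<forall>(H :: 'a ugraph) x. pair_graph H \<and> cov x \<G> H < \<infinity> \<longrightarrow>
            ereal_of_enat (icov x \<G> H) \<le> ereal (2 * d) * ereal_of_enat (cov x \<G> H) ^ 2)
       \<and> (\<forall>(\<H> :: 'a ugraph set) x. graph_class \<H> \<longrightarrow>
            param_bounded (icov x \<G>) (cov x \<G>) \<H>)"
proof (intro conjI allI impI)
  fix H :: "'a ugraph" and x
  assume "pair_graph H \<and> cov x \<G> H < \<infinity>"
  then obtain k n where "cov x \<G> H = enat k" "icov x \<G> H = enat n" "real n \<le> 2 * d * (real k)\<^sup>2"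
    using icov_bound[OF assms] by (metis less_infinityE)
  then show "ereal_of_enat (icov x \<G> H) \<le> ereal (2 * d) * ereal_of_enat (cov x \<G> H) ^ 2"
    by simp
next
  fix \<H> :: "'a ugraph set" and x
  assume \<H>: "graph_class \<H>"
  show "param_bounded (icov x \<G>) (cov x \<G>) \<H>"
    unfolding param_bounded_def
  proof (intro exI ballI impI)
    fix H assume "H \<in> \<H>" "cov x \<G> H < \<infinity>"
    then obtain k n where kn: "cov x \<G> H = enat k" "icov x \<G> H = enat n" "real n \<le> 2 * d * (real k)\<^sup>2"
      using icov_bound[OF assms] \<H> by (metis less_infinityE graph_class_def)
    then have "n \<le> nat \<lfloor>2 * d * (real k)\<^sup>2\<rfloor>"
      by (simp add: le_nat_floor)
    with kn show "icov x \<G> H \<le> enat (nat \<lfloor>2 * d * (real (the_enat (cov x \<G> H)))\<^sup>2\<rfloor>)"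
      by simp
  qed
qed

end
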